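(* For Büchi automata $A_1=(\mathcal{S}_1,\mathcal{E},\mathcal{I}_1,\mathcal{F}_1,\to_1)$ and $A_2=(\mathcal{S}_2,\mathcal{E},\mathcal{I}_2,\mathcal{F}_2,\to_2)$ over the same set of events, define for $X\subseteq\mathcal{S}_1\times\mathcal{S}_2$ $$\texttt{fsim}^\texttt{R}_\texttt{delay}(X)\triangleq\mu Y.\ \{(s_1,s_2)\mid s_2\in\mathcal{F}_2\wedge\forall e.\forall s_1\xrightarrow{e}_1 s_1'.\exists s_2\xrightarrow{e}_2 s_2'.\ (s_1',s_2')\in X\}\ \cup\ \{(s_1,s_2)\mid \forall e.\forall s_1\xrightarrow{e}_1 s_1'.\exists s_2\xrightarrow{e}_2 s_2'.\ (s_1',s_2')\in Y\},$$ $$\texttt{fsim}^\texttt{L}_\texttt{delay}\triangleq\nu X.\ \texttt{fsim}^\texttt{R}_\texttt{delay}(X)\ \cup\ \{(s_1,s_2)\mid s_1\notin\mathcal{F}_1\wedge\forall e.\forall s_1\xrightarrow{e}_1 s_1'.\exists s_2\xrightarrow{e}_2 s_2'.\ (s_1',s_2')\in X\},$$ $$\texttt{wait}(X)\triangleq\mu Y.\ \{(s_1,s_2)\mid\forall e.\forall s_1\xrightarrow{e}_1 s_1'.\exists s_2\xrightarrow{e}_2 s_2'.\ (s_1',s_2')\in Y\}\ \cup\ X,$$ and $\texttt{fsim}_\texttt{2delay}\triangleq\texttt{wait}(\texttt{fsim}^\texttt{L}_\texttt{delay})$. Then $\texttt{fsim}_\texttt{2delay}$ is strictly weaker than delay simulation: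 for every such pair of automata $\texttt{fsim}^\texttt{L}_\texttt{delay}\subseteq\texttt{fsim}_\texttt{2delay}$, and there exists a pair of Büchi automata for which $\texttt{fsim}^\texttt{L}_\texttt{delay}\subsetneq\texttt{fsim}_\texttt{2delay}$.
   Context: A Büchi automaton $(\mathcal{S},\mathcal{E},\mathcal{I},\mathcal{F},\to)$ consists of a set of states $\mathcal{S}$ (not necessarily finite), a set of events $\mathcal{E}$, initial states $\mathcal{I}\subseteq\mathcal{S}$, accepting states $\mathcal{F}\subseteq\mathcal{S}$, and a labeled transition relation $\to\subseteq\mathcal{S}\times\mathcal{E}\times\mathcal{S}$ (written $s\xrightarrow{e}s'$). $\nu$ and $\mu$ denote greatest and least fixed points of monotone operators on the powerset lattice of $\mathcal{S}_1\times\mathcal{S}_2$. *)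

theory Defs
  imports Main
begin

record ('s, 'e) buchi =
  states :: "'s set"
  events :: "'e set"
  initial :: "'s set"
  accepting :: "'s set"
  trans :: "('s \<times> 'e \<times> 's) set"

definition buchi_automaton :: "('s, 'e) buchi \<Rightarrow> bool" where
  "buchi_automaton A \<longleftrightarrow>
     initial A \<subseteq> states A \<and> accepting A \<subseteq> states A \<and>
     trans A \<subseteq> states A \<times> events A \<times> states A"

text \<open>
  The fixed points below are those of the powerset lattice of \<open>states A1 \<times> states A2\<close>. They are
  taken with \<^const>\<open>lfp\<close> and \<^const>\<open>gfp\<close> on the whole type of relations. This makes no difference for
  automata: \<open>sim_step\<close> only returns pairs of states, and, as transitions end in states, it
  depends only on the part of its argument inside \<open>states A1 \<times> states A2\<close>.
\<close>

definition sim_step ::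
  "('s1, 'e) buchi \<Rightarrow> ('s2, 'e) buchi \<Rightarrow> ('s1 \<times> 's2) set \<Rightarrow> ('s1 \<times> 's2) set" where
  "sim_step A1 A2 X =
     {(s1, s2) \<in> states A1 \<times> states A2.
        \<forall>e \<in> events A1. \<forall>s1'. (s1, e, s1') \<in> trans A1 \<longrightarrow>
          (\<exists>s2'. (s2, e, s2') \<in> trans A2 \<and> (s1', s2') \<in> X)}"

definition fsimR_delay ::
  "('s1, 'e) buchi \<Rightarrow> ('s2, 'e) buchi \<Rightarrow> ('s1 \<times> 's2) set \<Rightarrow> ('s1 \<times> 's2) set" where
  "fsimR_delay A1 A2 X =
     lfp (\<lambda>Y. {(s1, s2). s2 \<in> accepting A2 \<and> (s1, s2) \<in> sim_step A1 A2 X} \<union> sim_step A1 A2 Y)"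

definition fsimL_delay ::
  "('s1, 'e) buchi \<Rightarrow> ('s2, 'e) buchi \<Rightarrow> ('s1 \<times> 's2) set" where
  "fsimL_delay A1 A2 =
     gfp (\<lambda>X. fsimR_delay A1 A2 X \<union>
              {(s1, s2). s1 \<notin> accepting A1 \<and> (s1, s2) \<in> sim_step A1 A2 X})"

definition wait ::
  "('s1, 'e) buchi \<Rightarrow> ('s2, 'e) buchi \<Rightarrow> ('s1 \<times> 's2) set \<Rightarrow> ('s1 \<times> 's2) set" where
  "wait A1 A2 X = lfp (\<lambda>Y. sim_step A1 A2 Y \<union> X)"

definition fsim_2delay ::
  "('s1, 'e) buchi \<Rightarrow> ('s2, 'e) buchi \<Rightarrow> ('s1 \<times> 's2) set" where
  "fsim_2delay A1 A2 = wait A1 A2 (fsimL_delay A1 A2)"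

text \<open>All operators under \<^const>\<open>lfp\<close> and \<^const>\<open>gfp\<close> are monotone.\<close>

lemma mono_sim_step: "mono (sim_step A1 A2)"
  unfolding mono_def sim_step_def by blast

lemma mono_fsimR_delay_body:
  "mono (\<lambda>Y. {(s1, s2). s2 \<in> accepting A2 \<and> (s1, s2) \<in> sim_step A1 A2 X} \<union> sim_step A1 A2 Y)"
  using mono_sim_step[of A1 A2] unfolding mono_def by blast

lemma mono_fsimR_delay: "mono (fsimR_delay A1 A2)"
  unfolding fsimR_delay_def
  by (intro monoI lfp_mono) (use mono_sim_step[of A1 A2] in \<open>unfold mono_def, blast\<close>)

lemma mono_fsimL_delay_body:
  "mono (\<lambda>X. fsimR_delay A1 A2 X \<union>
             {(s1, s2). s1 \<notin> accepting A1 \<and> (s1, s2) \<in> sim_step A1 A2 X})"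
  using mono_fsimR_delay[of A1 A2] mono_sim_step[of A1 A2] unfolding mono_def by blast

lemma mono_wait_body: "mono (\<lambda>Y. sim_step A1 A2 Y \<union> X)"
  using mono_sim_step[of A1 A2] unfolding mono_def by blast

end

(* For strictness, A1 visits its accepting state once, at the start, and then loops forever in a
   non-accepting state, while A2 loops without ever accepting. Delay simulation fails at the start
   because A2 never answers the acceptance; waiting one step skips it. *)
theory Submission
  imports Defs
begin

lemma subset_wait: "X \<subseteq> wait A1 A2 X"
  unfolding wait_def by (subst lfp_unfold[OF mono_wait_body]) blast

text \<open>The least fixed point contains \<open>X\<close>, so one further unfolding of it also
  covers all pairs that reach \<open>X\<close> in one step.\<close>

lemma sim_step_subset_wait: "sim_step A1 A2 X \<subseteq> wait A1 A2 X"
proof -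
  have "sim_step A1 A2 X \<subseteq> sim_step A1 A2 (wait A1 A2 X)"
    by (rule monoD[OF mono_sim_step subset_wait])
  also have "\<dots> \<subseteq> wait A1 A2 X"
    unfolding wait_def by (subst (2) lfp_unfold[OF mono_wait_body]) blast
  finally show ?thesis .
qed

text \<open>Without accepting states in \<open>A2\<close> the fixed point has no base pairs from
  acceptance, and the second assumption excludes those from deadlocks, so the empty relation is
  already closed.\<close>

lemma fsimR_delay_eq_empty:
  assumes "accepting A2 = {}" and "sim_step A1 A2 {} = {}"
  shows "fsimR_delay A1 A2 X = {}"
proof -
  have "fsimR_delay A1 A2 X \<subseteq> {}"
    unfolding fsimR_delay_def by (rule lfp_lowerbound) (simp add: assms)
  then show ?thesis by blast
qed

text \<open>The loop at state 1 avoids a deadlock, whose pairs with states of \<open>A2\<close>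
  would enter \<open>fsimR_delay\<close> vacuously.\<close>

definition accept_once :: "(nat, nat) buchi" where
  "accept_once = \<lparr>states = {0, 1}, events = {0}, initial = {0}, accepting = {0},
     trans = {(0, 0, 1), (1, 0, 1)}\<rparr>"

definition accept_never :: "(nat, nat) buchi" where
  "accept_never = \<lparr>states = {0}, events = {0}, initial = {0}, accepting = {},
     trans = {(0, 0, 0)}\<rparr>"

lemma fsimR_delay_accept_once_never: "fsimR_delay accept_once accept_never X = {}"
  by (rule fsimR_delay_eq_empty) (auto simp: accept_once_def accept_never_def sim_step_def)

text \<open>As \<open>fsimR_delay\<close> is empty here, membership can only come from the disjunct
  that demands a non-accepting left state.\<close>

lemma start_notin_fsimL_delay: "(0, 0) \<notin> fsimL_delay accept_once accept_never"
proof
  assume "(0, 0) \<in> fsimL_delay accept_once accept_never"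
  then have "(0 :: nat) \<notin> accepting accept_once"
    unfolding fsimL_delay_def
    by (subst (asm) gfp_unfold[OF mono_fsimL_delay_body])
      (simp add: fsimR_delay_accept_once_never)
  then show False by (simp add: accept_once_def)
qed

text \<open>Coinduction with a singleton: state 1 is not accepting, and the two loops lead back to
  the same pair.\<close>

lemma loop_in_fsimL_delay: "(1, 0) \<in> fsimL_delay accept_once accept_never"
proof -
  have "{(1, 0)} \<subseteq> fsimL_delay accept_once accept_never"
    unfolding fsimL_delay_def
    by (rule gfp_upperbound) (auto simp: sim_step_def accept_once_def accept_never_def)
  then show ?thesis by simp
qed

lemma start_in_fsim_2delay: "(0, 0) \<in> fsim_2delay accept_once accept_never"
proof -
  \<comment> \<open>The only move from \<open>(0, 0)\<close> is to \<open>(1, 0)\<close>.\<close>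
  have "(0, 0) \<in> sim_step accept_once accept_never (fsimL_delay accept_once accept_never)"
    unfolding sim_step_def using loop_in_fsimL_delay
    by (simp add: accept_once_def accept_never_def)
  then show ?thesis
    unfolding fsim_2delay_def using sim_step_subset_wait by blast
qed

theorem theorem5p5:
  "(\<forall>(A1 :: ('s1, 'e) buchi) (A2 :: ('s2, 'e) buchi).
      buchi_automaton A1 \<and> buchi_automaton A2 \<and> events A1 = events A2 \<longrightarrow>
      fsimL_delay A1 A2 \<subseteq> fsim_2delay A1 A2) \<and>
   (\<exists>(A1 :: (nat, nat) buchi) (A2 :: (nat, nat) buchi).
      buchi_automaton A1 \<and> buchi_automaton A2 \<and> events A1 = events A2 \<and>
      fsimL_delay A1 A2 \<subset> fsim_2delay A1 A2)"
proof (intro conjI allI impI exI)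
  show "fsimL_delay A1 A2 \<subseteq> fsim_2delay A1 A2"
    for A1 :: "('s1, 'e) buchi" and A2 :: "('s2, 'e) buchi"
    unfolding fsim_2delay_def by (rule subset_wait)
  \<comment> \<open>This fixes the two witnesses left open by \<open>exI\<close>; the separating
    pair is \<open>(0, 0)\<close>.\<close>
  show "fsimL_delay accept_once accept_never \<subset> fsim_2delay accept_once accept_never"
    using start_notin_fsimL_delay start_in_fsim_2delay subset_wait
    unfolding fsim_2delay_def by blast
qed (simp_all add: buchi_automaton_def accept_once_def accept_never_def)

end
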